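(* Let $n$ be a positive integer, let $\Lambda_n=\mathrm{diag}(\lambda_1,\dots,\lambda_n)\in \mathrm{Mat}(n,\mathbb{C})$ be a diagonal matrix whose eigenvalues $\lambda_1,\dots,\lambda_n$ are pairwise distinct and all nonzero, and let $A_n=(a_{km})_{k,m=1}^n\in \mathrm{Mat}(n,\mathbb{C})$ be an arbitrary matrix. Then: (i) the family of two matrices $(\Lambda_n,A_n)$ is irreducible if and only if the set $\{E_{km}\mid (k,m)\in \mathrm{Supp}(A_n)\}$ generates the algebra $\mathrm{Mat}(n,\mathbb{C})$; (ii) the family $(\Lambda_n,A_n)$ is Schur irreducible if and only if the set $\{E_{km}\mid (k,m)\in \mathrm{Supp}(A_n)\cup \mathrm{Supp}(A_n^t)\}$ generates the algebra $\mathrm{Mat}(n,\mathbb{C})$; (iii) the family $(\Lambda_n,A_n)$ is indecomposable if and only if it is Schur irreducible.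
   Context: $\mathrm{Mat}(n,\mathbb{C})$ is the algebra of complex $n\times n$ matrices, acting on $\mathbb{C}^n$. $E_{km}$ is the matrix unit with entry $1$ at position $(k,m)$ and all other entries $0$. For $A=(a_{km})_{k,m=1}^n$, the support is $\mathrm{Supp}(A)=\{(k,m)\in\{1,\dots,n\}^2\mid a_{km}\neq 0\}$, and $A^t$ denotes the transpose. "Generates" means generates as an associative algebra. A family of matrices in $\mathrm{Mat}(n,\mathbb{C})$ is called irreducible if no linear subspace of $\mathbb{C}^n$ other than $\{0\}$ and $\mathbb{C}^n$ is invariant under all matrices of the family; Schur irreducible if the only matrices in $\mathrm{Mat}(n,\mathbb{C})$ commuting with all matrices of the family are the scalar multiples of the identity; indecomposable if $\mathbb{C}^n$ cannot be written as a direct sum $V_1\oplus V_2$ of two nonzero subspaces each invariant under all matrices of the family. *)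

theory Defs
  imports "HOL-Analysis.Analysis"
begin

definition diag_matrix :: "('n::finite \<Rightarrow> complex) \<Rightarrow> complex^'n^'n" where
  "diag_matrix l = (\<chi> k m. if k = m then l k else 0)"

definition matrix_unit :: "'n::finite \<times> 'n \<Rightarrow> complex^'n^'n" where
  "matrix_unit p = (\<chi> i j. if (i, j) = p then 1 else 0)"

definition matrix_supp :: "complex^'n^'n \<Rightarrow> ('n::finite \<times> 'n) set" where
  "matrix_supp A = {(k, m). A $ k $ m \<noteq> 0}"

text \<open>
  Algebras are associative and unital. Without the unit the correspondence between
  irreducibility and generation fails in dimension one: a pair of a nonzero number and \<open>0\<close>
  acts irreducibly on the line, but the support of \<open>0\<close> is empty.
\<close>
definition matrix_subalgebra :: "(complex^'n^'n) set \<Rightarrow> bool" where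
  "matrix_subalgebra S \<longleftrightarrow>
     mat 1 \<in> S \<and>
     (\<forall>X\<in>S. \<forall>Y\<in>S. X + Y \<in> S) \<and>
     (\<forall>c. \<forall>X\<in>S. map_matrix ((*) c) X \<in> S) \<and>
     (\<forall>X\<in>S. \<forall>Y\<in>S. X ** Y \<in> S)"

definition generates_matrix_algebra :: "(complex^'n^'n) set \<Rightarrow> bool" where
  "generates_matrix_algebra G \<longleftrightarrow> matrix_subalgebra hull G = UNIV"

text \<open>
  Subspaces are complex ones, hence \<open>vec.subspace\<close>; the unqualified \<open>subspace\<close> would be
  the real notion.
\<close>
definition invariant_subspace :: "(complex^'n^'n) set \<Rightarrow> (complex^'n) set \<Rightarrow> bool" where
  "invariant_subspace F V \<longleftrightarrow> vec.subspace V \<and> (\<forall>X\<in>F. \<forall>v\<in>V. X *v v \<in> V)"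

definition irreducible_family :: "(complex^'n^'n) set \<Rightarrow> bool" where
  "irreducible_family F \<longleftrightarrow> (\<forall>V. invariant_subspace F V \<longrightarrow> V = {0} \<or> V = UNIV)"

definition Schur_irreducible_family :: "(complex^'n^'n) set \<Rightarrow> bool" where
  "Schur_irreducible_family F \<longleftrightarrow>
     (\<forall>X. (\<forall>Y\<in>F. X ** Y = Y ** X) \<longrightarrow> (\<exists>c. X = mat c))"

definition indecomposable_family :: "(complex^'n^'n) set \<Rightarrow> bool" where
  "indecomposable_family F \<longleftrightarrow>
     \<not> (\<exists>V\<^sub>1 V\<^sub>2. invariant_subspace F V\<^sub>1 \<and> invariant_subspace F V\<^sub>2 \<and>
          V\<^sub>1 \<noteq> {0} \<and> V\<^sub>2 \<noteq> {0} \<and>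
          V\<^sub>1 \<inter> V\<^sub>2 = {0} \<and> {x + y | x y. x \<in> V\<^sub>1 \<and> y \<in> V\<^sub>2} = UNIV)"

end

theory Submission
  imports Defs
begin

text \<open>
  Read \<open>Supp A\<close> as the edge set of a digraph on the index set. Since the \<open>\<lambda>\<^sub>k\<close> are
  distinct, a subspace invariant under \<open>\<Lambda>\<close> contains the basis vector \<open>e\<^sub>k\<close> as soon as one of
  its elements has a nonzero \<open>k\<close>-th entry, and a matrix commuting with \<open>\<Lambda>\<close> is diagonal. Hence
  invariant subspaces correspond to sets of vertices closed under the edges, and matrices in the
  commutant to functions that are constant along edges. Both generation conditions, irreducibility
  (strong connectivity), and Schur irreducibility and indecomposability (connectivity of the
  symmetrised graph) thus become statements about reachability.
\<close>

section \<open>Matrix subalgebras and generation by matrix units\<close>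

lemma matrix_subalgebra_scale:
  "matrix_subalgebra S \<Longrightarrow> X \<in> S \<Longrightarrow> map_matrix ((*) c) X \<in> S"
  by (simp add: matrix_subalgebra_def)

lemma matrix_subalgebra_mult:
  "matrix_subalgebra S \<Longrightarrow> X \<in> S \<Longrightarrow> Y \<in> S \<Longrightarrow> X ** Y \<in> S"
  by (simp add: matrix_subalgebra_def)

lemma matrix_subalgebra_zero:
  assumes "matrix_subalgebra S"
  shows "0 \<in> S"
proof -
  have "map_matrix ((*) 0) (mat 1) = (0 :: complex^'n^'n)"
    by (simp add: vec_eq_iff map_matrix_def)
  moreover have "mat 1 \<in> S"
    using assms by (simp add: matrix_subalgebra_def)
  ultimately show ?thesis
    using matrix_subalgebra_scale[OF assms, of "mat 1" 0] by metis
qed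

lemma matrix_subalgebra_sum:
  assumes "matrix_subalgebra S" "\<And>i. i \<in> I \<Longrightarrow> f i \<in> S"
  shows "sum f I \<in> S"
  using assms(2)
proof (induction I rule: infinite_finite_induct)
  case (insert i I)
  then show ?case
    using assms(1) by (simp add: matrix_subalgebra_def)
qed (use matrix_subalgebra_zero[OF assms(1)] in auto)

lemma matrix_subalgebra_hull: "matrix_subalgebra (matrix_subalgebra hull G)"
proof (rule hull_in[where S = matrix_subalgebra])
  fix T :: "(complex^'n^'n) set set"
  assume "Ball T matrix_subalgebra"
  then show "matrix_subalgebra (\<Inter>T)"
    by (simp add: matrix_subalgebra_def)
qed

lemma matrix_unit_mult: "matrix_unit (i, j) ** matrix_unit (j, k) = matrix_unit (i, k)"
proof -
  have "(matrix_unit (i, j) ** matrix_unit (j, k)) $ a $ b =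
      (\<Sum>c\<in>UNIV. if c = j then matrix_unit (i, k) $ a $ b else 0)" for a b
    unfolding matrix_unit_def matrix_matrix_mult_def vec_lambda_beta by (rule sum.cong) auto
  then show ?thesis
    by (simp add: vec_eq_iff)
qed

lemma matrix_eq_sum_units:
  "X = (\<Sum>p\<in>UNIV. map_matrix ((*) (X $ fst p $ snd p)) (matrix_unit p))"
proof -
  have "(\<Sum>p\<in>UNIV. map_matrix ((*) (X $ fst p $ snd p)) (matrix_unit p)) $ i $ j = X $ i $ j" for i j
  proof -
    have "(\<Sum>p\<in>UNIV. map_matrix ((*) (X $ fst p $ snd p)) (matrix_unit p)) $ i $ j =
        (\<Sum>p\<in>UNIV. if p = (i, j) then X $ i $ j else 0)"
      unfolding sum_component by (rule sum.cong) (auto simp: map_matrix_def matrix_unit_def)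
    then show ?thesis
      by simp
  qed
  then show ?thesis
    by (simp add: vec_eq_iff)
qed

text \<open>Nonempty products of generators are zero or the units of paths in \<open>R\<close>; the
  identity matrix accounts for the reflexive part of \<open>R\<^sup>*\<close>.\<close>

lemma generates_matrix_units_iff:
  fixes R :: "('n::finite \<times> 'n) set"
  shows "generates_matrix_algebra (matrix_unit ` R) \<longleftrightarrow> R\<^sup>* = UNIV"
proof
  assume gen: "generates_matrix_algebra (matrix_unit ` R)"
  \<comment> \<open>\<open>S\<close> is the incidence algebra of the preorder
    \<open>R\<^sup>*\<close>: reflexivity gives the identity, transitivity gives closure under
    products.\<close>
  define S where "S = {X :: complex^'n^'n. \<forall>i j. X $ i $ j \<noteq> 0 \<longrightarrow> (i, j) \<in> R\<^sup>*}"
  have "matrix_subalgebra S"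
    unfolding matrix_subalgebra_def
  proof (intro conjI ballI allI)
    show "mat 1 \<in> S"
      by (auto simp: S_def mat_def)
  next
    fix X Y assume "X \<in> S" "Y \<in> S"
    then show "X + Y \<in> S"
      by (auto simp: S_def) (metis add.right_neutral)
  next
    fix c X assume "X \<in> S"
    then show "map_matrix ((*) c) X \<in> S"
      by (auto simp: S_def map_matrix_def)
  next
    fix X Y assume XY: "X \<in> S" "Y \<in> S"
    show "X ** Y \<in> S"
      unfolding S_def
    proof (intro CollectI allI impI)
      fix i j assume "(X ** Y) $ i $ j \<noteq> 0"
      then obtain k where "X $ i $ k * Y $ k $ j \<noteq> 0"
        by (auto simp: matrix_matrix_mult_def elim: sum.not_neutral_contains_not_neutral)
      with XY have "(i, k) \<in> R\<^sup>*" "(k, j) \<in> R\<^sup>*"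
        by (auto simp: S_def)
      then show "(i, j) \<in> R\<^sup>*"
        by (rule rtrancl_trans)
    qed
  qed
  moreover have "matrix_unit ` R \<subseteq> S"
    by (auto simp: S_def matrix_unit_def split: if_splits)
  ultimately have "matrix_subalgebra hull (matrix_unit ` R) \<subseteq> S"
    by (rule hull_minimal[rotated])
  with gen have S: "matrix_unit (i, j) \<in> S" for i j
    by (auto simp: generates_matrix_algebra_def)
  have "(i, j) \<in> R\<^sup>*" for i j
    using S[of i j] by (auto simp: S_def matrix_unit_def)
  then show "R\<^sup>* = UNIV"
    by auto
next
  assume R: "R\<^sup>* = UNIV"
  define H where "H = matrix_subalgebra hull (matrix_unit ` R)"
  have H: "matrix_subalgebra H"
    unfolding H_def by (rule matrix_subalgebra_hull)
  have edge: "matrix_unit p \<in> H" if "p \<in> R" for p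
    unfolding H_def using that by (auto intro: hull_inc)
  \<comment> \<open>Only nonempty paths arise as products of generators, hence
    \<open>R\<^sup>+\<close>; the empty path yields the identity and not a single diagonal
    unit.\<close>
  have path: "matrix_unit (i, j) \<in> H" if "(i, j) \<in> R\<^sup>+" for i j
    using that
  proof (induction rule: trancl_induct)
    case (base j)
    then show ?case by (rule edge)
  next
    case (step j k)
    then show ?case
      using matrix_subalgebra_mult[OF H step.IH edge[OF step.hyps(2)]] by (simp add: matrix_unit_mult)
  qed
  have unit: "matrix_unit (i, j) \<in> H" for i j
  proof (cases "(i, j) \<in> R\<^sup>+")
    case True
    then show ?thesis by (rule path)
  next
    case False
    have plus: "(a, b) \<in> R\<^sup>+" if "a \<noteq> b" for a b
      using R that by (metis UNIV_I rtranclD)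
    \<comment> \<open>An index on no cycle is the only index, and then \<open>E\<^sub>i\<^sub>i\<close> is the identity matrix.\<close>
    have "a = i" for a
      using False plus by (metis trancl_trans)
    then have "a = i \<and> b = j \<and> a = b" for a b
      by metis
    then have "matrix_unit (i, j) = (mat 1 :: complex^'n^'n)"
      unfolding matrix_unit_def mat_def vec_eq_iff by simp
    then show ?thesis
      using H by (simp add: matrix_subalgebra_def)
  qed
  have "X \<in> H" for X
    by (subst matrix_eq_sum_units)
      (intro matrix_subalgebra_sum[OF H] matrix_subalgebra_scale[OF H], metis unit prod.collapse)
  then show "generates_matrix_algebra (matrix_unit ` R)"
    by (auto simp: generates_matrix_algebra_def H_def)
qed

section \<open>Diagonal matrices with distinct entries: commutant and invariant subspaces\<close>

lemma diag_matrix_mult_vec: "diag_matrix l *v v = (\<chi> i. l i * v $ i)"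
proof -
  have "(diag_matrix l *v v) $ i = (\<Sum>k\<in>UNIV. if k = i then l i * v $ i else 0)" for i
    unfolding diag_matrix_def matrix_vector_mult_def vec_lambda_beta by (rule sum.cong) auto
  then show ?thesis by (simp add: vec_eq_iff)
qed

lemma diag_matrix_mult_left: "(diag_matrix x ** B) $ i $ j = x i * B $ i $ j"
proof -
  have "(diag_matrix x ** B) $ i $ j = (\<Sum>k\<in>UNIV. if k = i then x i * B $ i $ j else 0)"
    unfolding diag_matrix_def matrix_matrix_mult_def vec_lambda_beta by (rule sum.cong) auto
  then show ?thesis by simp
qed

lemma diag_matrix_mult_right: "(B ** diag_matrix x) $ i $ j = B $ i $ j * x j"
proof -
  have "(B ** diag_matrix x) $ i $ j = (\<Sum>k\<in>UNIV. if k = j then B $ i $ j * x j else 0)"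
    unfolding diag_matrix_def matrix_matrix_mult_def vec_lambda_beta by (rule sum.cong) auto
  then show ?thesis by simp
qed

text \<open>Comparing entries at \<open>(i, j)\<close> gives
  \<open>(l i - l j) * X $ i $ j = 0\<close>.\<close>

lemma commutes_with_distinct_diag:
  assumes "inj l" and comm: "X ** diag_matrix l = diag_matrix l ** X"
  shows "X = diag_matrix (\<lambda>i. X $ i $ i)"
proof -
  have "X $ i $ j = 0" if "i \<noteq> j" for i j
  proof -
    have "X $ i $ j * l j = l i * X $ i $ j"
      using arg_cong[OF comm, of "\<lambda>B. B $ i $ j"]
      by (simp add: diag_matrix_mult_left diag_matrix_mult_right)
    moreover have "l i \<noteq> l j"
      using \<open>inj l\<close> that by (auto dest: injD)
    ultimately show ?thesis by (simp add: mult.commute)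
  qed
  then show ?thesis
    by (auto simp: diag_matrix_def vec_eq_iff)
qed

text \<open>The projection onto \<open>e\<^sub>k\<close> is, up to a nonzero factor, the product of all
  \<open>\<Lambda> - \<lambda>\<^sub>j\<close> with \<open>j \<noteq> k\<close>.\<close>

lemma axis_mem_invariant_subspace:
  fixes l :: "'n::finite \<Rightarrow> complex"
  assumes inj: "inj l" and V: "invariant_subspace F V" and D: "diag_matrix l \<in> F"
    and v: "v \<in> V" "v $ k \<noteq> 0"
  shows "axis k 1 \<in> V"
proof -
  have sub: "vec.subspace V"
    using V by (simp add: invariant_subspace_def)
  \<comment> \<open>The factors are applied one at a time; the one for \<open>j\<close> multiplies
    entry \<open>i\<close> by \<open>l i - l j\<close> and stays within \<open>V\<close>.\<close>
  have J: "(\<chi> i. (\<Prod>j\<in>J. l i - l j) * v $ i) \<in> V" if "finite J" for J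
    using that
  proof (induction J rule: finite_induct)
    case empty
    then show ?case using v by simp
  next
    case (insert m J)
    let ?w = "\<chi> i. (\<Prod>j\<in>J. l i - l j) * v $ i"
    have "diag_matrix l *v ?w - l m *s ?w \<in> V"
      using V D insert.IH sub
      by (auto simp: invariant_subspace_def intro!: vec.subspace_diff vec.subspace_scale)
    moreover have "diag_matrix l *v ?w - l m *s ?w = (\<chi> i. (\<Prod>j\<in>insert m J. l i - l j) * v $ i)"
      using insert.hyps by (simp add: diag_matrix_mult_vec vec_eq_iff algebra_simps)
    ultimately show ?case by simp
  qed
  \<comment> \<open>For \<open>J = -{k}\<close> every entry other than the \<open>k\<close>-th is
    killed; \<open>c\<close> is the surviving one.\<close>
  define c where "c = (\<Prod>j\<in>-{k}. l k - l j) * v $ k"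
  have "c \<noteq> 0"
    using v inj by (auto simp: c_def dest: injD)
  have "(\<Prod>j\<in>-{k}. l i - l j) = 0" if "i \<noteq> k" for i
    using that by (intro prod_zero) auto
  then have "(\<chi> i. (\<Prod>j\<in>-{k}. l i - l j) * v $ i) = c *s axis k 1"
    by (auto simp: vec_eq_iff axis_def c_def)
  with J[of "-{k}"] have "c *s axis k 1 \<in> V" by simp
  from vec.subspace_scale[OF sub this, of "inverse c"] show ?thesis
    using \<open>c \<noteq> 0\<close> by (simp add: vector_smult_assoc)
qed

lemma matrix_vector_mult_axis: "(B *v axis k 1) $ i = (B $ i $ k :: complex)"
proof -
  have "(B *v axis k 1) $ i = (\<Sum>j\<in>UNIV. if j = k then B $ i $ k else 0)"
    unfolding axis_def matrix_vector_mult_def vec_lambda_beta by (rule sum.cong) auto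
  then show ?thesis by simp
qed

text \<open>The image of \<open>axis k 1\<close> under \<open>A\<close> is column \<open>k\<close>,
  so membership travels along an edge \<open>(i, k)\<close> backwards, from \<open>k\<close> to
  \<open>i\<close>.\<close>

lemma axis_mem_invariant_subspace_step:
  fixes l :: "'n::finite \<Rightarrow> complex"
  assumes "inj l" and V: "invariant_subspace {diag_matrix l, A} V"
    and "axis k 1 \<in> V" "(i, k) \<in> matrix_supp A"
  shows "axis i 1 \<in> V"
proof (rule axis_mem_invariant_subspace[OF \<open>inj l\<close> V])
  show "A *v axis k 1 \<in> V"
    using assms by (simp add: invariant_subspace_def)
  show "(A *v axis k 1) $ i \<noteq> 0"
    using assms by (simp add: matrix_supp_def matrix_vector_mult_axis)
qed simp

lemma invariant_subspace_nonzero_axis: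
  fixes l :: "'n::finite \<Rightarrow> complex"
  assumes "inj l" and V: "invariant_subspace {diag_matrix l, A} V" and "V \<noteq> {0}"
  obtains k where "axis k 1 \<in> V"
proof -
  have "0 \<in> V"
    using V by (simp add: invariant_subspace_def vec.subspace_0)
  with \<open>V \<noteq> {0}\<close> obtain v where "v \<in> V" "v \<noteq> 0"
    by auto
  then obtain k where "v $ k \<noteq> 0"
    by (auto simp: vec_eq_iff)
  with \<open>v \<in> V\<close> have "axis k 1 \<in> V"
    by (intro axis_mem_invariant_subspace[OF \<open>inj l\<close> V]) auto
  then show ?thesis by (rule that)
qed

lemma subspace_eq_UNIV_if_axes:
  fixes V :: "(complex^'n::finite) set"
  assumes V: "vec.subspace V" and ax: "\<And>i. axis i 1 \<in> V"
  shows "V = UNIV"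
proof -
  have "v \<in> V" for v
    by (subst basis_expansion[of v, symmetric])
      (intro vec.subspace_sum[OF V] vec.subspace_scale[OF V] ax)
  then show ?thesis by auto
qed

section \<open>Coordinate subspaces\<close>

text \<open>This is the span of the axis vectors indexed by \<open>K\<close>, given by vanishing
  entries so that membership is checked entrywise.\<close>

definition coordinate_subspace :: "'n set \<Rightarrow> (complex^'n::finite) set" where
  "coordinate_subspace K = {v. \<forall>i. i \<notin> K \<longrightarrow> v $ i = 0}"

lemma axis_mem_coordinate_subspace: "axis k 1 \<in> coordinate_subspace K \<longleftrightarrow> k \<in> K"
  by (auto simp: coordinate_subspace_def axis_def)

lemma coordinate_subspace_eq_UNIV: "coordinate_subspace K = UNIV \<Longrightarrow> K = UNIV"
  using axis_mem_coordinate_subspace[of _ K] by auto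

lemma coordinate_subspace_nonzero:
  assumes "k \<in> K"
  shows "coordinate_subspace K \<noteq> {0}"
proof -
  have "axis k 1 \<in> coordinate_subspace K"
    using assms by (simp add: axis_mem_coordinate_subspace)
  moreover have "axis k (1::complex) \<noteq> 0"
    by (simp add: axis_eq_0_iff)
  ultimately show ?thesis by blast
qed

lemma coordinate_subspace_Int_Compl:
  fixes K :: "'n::finite set"
  shows "coordinate_subspace K \<inter> coordinate_subspace (- K) = {0}"
proof (intro equalityI subsetI)
  fix v assume v: "v \<in> coordinate_subspace K \<inter> coordinate_subspace (- K)"
  have "v $ i = 0" for i
    using v by (cases "i \<in> K") (simp_all add: coordinate_subspace_def)
  then show "v \<in> {0}"
    by (simp add: vec_eq_iff)
qed (simp add: coordinate_subspace_def)

lemma coordinate_subspace_plus_Compl: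
  fixes K :: "'n::finite set"
  shows "{x + y | x y. x \<in> coordinate_subspace K \<and> y \<in> coordinate_subspace (- K)} = UNIV"
proof -
  have "\<exists>x y. v = x + y \<and> x \<in> coordinate_subspace K \<and> y \<in> coordinate_subspace (- K)" for v
  proof (intro exI conjI)
    show "v = (\<chi> j. if j \<in> K then v $ j else 0) + (\<chi> j. if j \<in> K then 0 else v $ j)"
      by (simp add: vec_eq_iff)
  qed (simp_all add: coordinate_subspace_def)
  then show ?thesis by blast
qed

text \<open>For \<open>i\<close> outside \<open>K\<close>, each summand
  \<open>A $ i $ j * v $ j\<close> vanishes: either \<open>j\<close> is outside \<open>K\<close> and
  \<open>v $ j = 0\<close>, or a nonzero \<open>A $ i $ j\<close> would force \<open>i\<close> into
  \<open>K\<close>.\<close>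

lemma invariant_coordinate_subspace:
  assumes closed: "\<And>i k. (i, k) \<in> matrix_supp A \<Longrightarrow> k \<in> K \<Longrightarrow> i \<in> K"
  shows "invariant_subspace {diag_matrix l, A} (coordinate_subspace K)"
proof -
  have "vec.subspace (coordinate_subspace K)"
    by (auto simp: vec.subspace_def coordinate_subspace_def)
  moreover have "diag_matrix l *v v \<in> coordinate_subspace K" if "v \<in> coordinate_subspace K" for v
    using that by (simp add: coordinate_subspace_def diag_matrix_mult_vec)
  moreover have "A *v v \<in> coordinate_subspace K" if v: "v \<in> coordinate_subspace K" for v
  proof -
    have "A $ i $ j * v $ j = 0" if "i \<notin> K" for i j
      using v closed[of i j] that by (auto simp: coordinate_subspace_def matrix_supp_def)
    then show ?thesis
      unfolding coordinate_subspace_def matrix_vector_mult_def by (auto intro!: sum.neutral)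
  qed
  ultimately show ?thesis
    by (auto simp: invariant_subspace_def)
qed

section \<open>Irreducibility as strong connectivity\<close>

lemma irreducible_iff_strongly_connected:
  fixes l :: "'n::finite \<Rightarrow> complex"
  assumes "inj l"
  shows "irreducible_family {diag_matrix l, A} \<longleftrightarrow> (matrix_supp A)\<^sup>* = UNIV"
proof
  assume irr: "irreducible_family {diag_matrix l, A}"
  have "(i, k) \<in> (matrix_supp A)\<^sup>*" for i k
  proof -
    \<comment> \<open>\<open>?K\<close> is the smallest set that contains \<open>k\<close> and is
      closed under predecessors.\<close>
    let ?K = "{j. (j, k) \<in> (matrix_supp A)\<^sup>*}"
    have "invariant_subspace {diag_matrix l, A} (coordinate_subspace ?K)"
      by (rule invariant_coordinate_subspace) (auto intro: converse_rtrancl_into_rtrancl)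
    with irr have "coordinate_subspace ?K = UNIV"
      using coordinate_subspace_nonzero[of k ?K] by (auto simp: irreducible_family_def)
    then show ?thesis
      using coordinate_subspace_eq_UNIV by blast
  qed
  then show "(matrix_supp A)\<^sup>* = UNIV" by auto
next
  assume conn: "(matrix_supp A)\<^sup>* = UNIV"
  have "V = UNIV" if V: "invariant_subspace {diag_matrix l, A} V" "V \<noteq> {0}" for V
  proof -
    obtain k where k: "axis k 1 \<in> V"
      using invariant_subspace_nonzero_axis[OF assms V] by blast
    have "axis i 1 \<in> V" for i
    proof -
      have "(i, k) \<in> (matrix_supp A)\<^sup>*" using conn by simp
      then show ?thesis
      \<comment> \<open>The induction starts at the end \<open>k\<close> of the path, matching the
        direction in which \<open>A\<close> propagates axis vectors.\<close>
      proof (induction rule: converse_rtrancl_induct)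
        case (step i j)
        show ?case
          by (rule axis_mem_invariant_subspace_step[OF assms V(1) step.IH step.hyps(1)])
      qed (rule k)
    qed
    moreover have "vec.subspace V"
      using V by (simp add: invariant_subspace_def)
    ultimately show ?thesis
      by (intro subspace_eq_UNIV_if_axes)
  qed
  then show "irreducible_family {diag_matrix l, A}"
    by (auto simp: irreducible_family_def)
qed

section \<open>Schur irreducibility and the symmetrised graph\<close>

lemma matrix_supp_transpose: "matrix_supp (transpose A) = (matrix_supp A)\<inverse>"
  by (auto simp: matrix_supp_def transpose_def)

lemma rtrancl_symcl_step:
  assumes "(i, j) \<in> R"
  shows "(i, k) \<in> (R \<union> R\<inverse>)\<^sup>* \<longleftrightarrow> (j, k) \<in> (R \<union> R\<inverse>)\<^sup>*"
proof -
  have "(i, j) \<in> R \<union> R\<inverse>" "(j, i) \<in> R \<union> R\<inverse>" using assms by auto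
  then show ?thesis by (meson converse_rtrancl_into_rtrancl)
qed

lemma Schur_irreducible_iff_connected:
  fixes l :: "'n::finite \<Rightarrow> complex"
  assumes "inj l"
  shows "Schur_irreducible_family {diag_matrix l, A} \<longleftrightarrow>
    (matrix_supp A \<union> (matrix_supp A)\<inverse>)\<^sup>* = UNIV" (is "_ \<longleftrightarrow> ?Q\<^sup>* = UNIV")
proof
  assume schur: "Schur_irreducible_family {diag_matrix l, A}"
  have "(i, k) \<in> ?Q\<^sup>*" for i k
  proof -
    \<comment> \<open>\<open>x\<close> is the indicator of the connected component of
      \<open>k\<close>. It is constant along edges, so its diagonal matrix lies in the commutant;
      being scalar then forces \<open>x i = x k = 1\<close>.\<close>
    define x :: "'n \<Rightarrow> complex" where "x j = of_bool ((j, k) \<in> ?Q\<^sup>*)" for j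
    have "x i = x j" if "A $ i $ j \<noteq> 0" for i j
    proof -
      have "(i, j) \<in> matrix_supp A" using that by (simp add: matrix_supp_def)
      from rtrancl_symcl_step[OF this] show ?thesis by (simp add: x_def)
    qed
    then have "x i * A $ i $ j = A $ i $ j * x j" for i j
      by (cases "A $ i $ j = 0") (auto simp: mult.commute)
    then have "diag_matrix x ** A = A ** diag_matrix x"
      by (simp add: vec_eq_iff diag_matrix_mult_left diag_matrix_mult_right)
    moreover have "diag_matrix x ** diag_matrix l = diag_matrix l ** diag_matrix x"
      by (simp add: vec_eq_iff diag_matrix_mult_left diag_matrix_mult_right)
        (simp add: diag_matrix_def)
    ultimately obtain c where c: "diag_matrix x = mat c"
      using schur unfolding Schur_irreducible_family_def by blast
    have "x j = c" for j
      using arg_cong[OF c, of "\<lambda>B. B $ j $ j"] by (simp add: diag_matrix_def mat_def)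
    then have "x i = x k" by simp
    then show ?thesis by (simp add: x_def split: if_splits)
  qed
  then show "?Q\<^sup>* = UNIV" by auto
next
  assume conn: "?Q\<^sup>* = UNIV"
  have "\<exists>c. X = mat c"
    if comm: "X ** diag_matrix l = diag_matrix l ** X" "X ** A = A ** X" for X
  proof -
    define x where "x i = X $ i $ i" for i
    have X: "X = diag_matrix x"
      using commutes_with_distinct_diag[OF assms comm(1)] by (simp add: x_def[abs_def])
    have entry: "x i * A $ i $ j = A $ i $ j * x j" for i j
      using arg_cong[OF comm(2), of "\<lambda>B. B $ i $ j"]
      by (simp add: X diag_matrix_mult_left diag_matrix_mult_right)
    have "x i = x j" if "(i, j) \<in> matrix_supp A" for i j
      using that entry[of i j] by (simp add: matrix_supp_def mult.commute)
    then have edge: "x i = x j" if "(i, j) \<in> ?Q" for i j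
      using that by auto
    have "x i = x j" for i j
    proof -
      have "(i, j) \<in> ?Q\<^sup>*" using conn by simp
      then show ?thesis by (induction rule: rtrancl_induct) (use edge in metis)+
    qed
    \<comment> \<open>Since \<open>x\<close> is constant, its value at an arbitrary index is the
      scalar.\<close>
    then have "X = mat (x undefined)"
      by (auto simp: X diag_matrix_def mat_def vec_eq_iff)
    then show ?thesis by blast
  qed
  then show "Schur_irreducible_family {diag_matrix l, A}"
    by (auto simp: Schur_irreducible_family_def)
qed

section \<open>Indecomposability and the symmetrised graph\<close>

text \<open>A component and its complement split the space if the graph is disconnected. Conversely,
  in a decomposition each axis vector lies in exactly one summand, and no edge joins the two classes
  of indices.\<close>

lemma indecomposable_iff_connected:
  fixes l :: "'n::finite \<Rightarrow> complex"
  assumes "inj l"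
  shows "indecomposable_family {diag_matrix l, A} \<longleftrightarrow>
    (matrix_supp A \<union> (matrix_supp A)\<inverse>)\<^sup>* = UNIV" (is "_ \<longleftrightarrow> ?Q\<^sup>* = UNIV")
proof
  assume indec: "indecomposable_family {diag_matrix l, A}"
  show "?Q\<^sup>* = UNIV"
  proof (rule ccontr)
    assume "?Q\<^sup>* \<noteq> UNIV"
    then obtain i k where ik: "(i, k) \<notin> ?Q\<^sup>*" by auto
    let ?K = "{j. (j, k) \<in> ?Q\<^sup>*}"
    let ?V = "coordinate_subspace ?K" and ?W = "coordinate_subspace (- ?K)"
    \<comment> \<open>Components of the symmetrised graph are closed in both directions, so the
      complement of \<open>?K\<close> also gives an invariant subspace.\<close>
    have closed: "i \<in> ?K \<longleftrightarrow> j \<in> ?K" if "(i, j) \<in> matrix_supp A" for i j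
      using rtrancl_symcl_step[OF that] by simp
    have "invariant_subspace {diag_matrix l, A} ?V"
      by (rule invariant_coordinate_subspace) (use closed in blast)
    moreover have "invariant_subspace {diag_matrix l, A} ?W"
      by (rule invariant_coordinate_subspace) (use closed in blast)
    moreover have "?V \<noteq> {0}" "?W \<noteq> {0}"
      using coordinate_subspace_nonzero[of k ?K] coordinate_subspace_nonzero[of i "- ?K"] ik by auto
    moreover note coordinate_subspace_Int_Compl[of ?K] coordinate_subspace_plus_Compl[of ?K]
    ultimately show False
      using indec unfolding indecomposable_family_def by blast
  qed
next
  assume conn: "?Q\<^sup>* = UNIV"
  show "indecomposable_family {diag_matrix l, A}"
    unfolding indecomposable_family_def
  proof clarify
    fix V W
    assume V: "invariant_subspace {diag_matrix l, A} V" "V \<noteq> {0}"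
      and W: "invariant_subspace {diag_matrix l, A} W" "W \<noteq> {0}"
      and VW: "V \<inter> W = {0}" and sum: "{x + y | x y. x \<in> V \<and> y \<in> W} = UNIV"
    have not_both: "\<not> (axis j 1 \<in> V \<and> axis j 1 \<in> W)" for j
    proof
      assume "axis j 1 \<in> V \<and> axis j 1 \<in> W"
      then have "axis j (1::complex) = 0"
        using VW by blast
      then show False
        by (simp add: axis_eq_0_iff)
    qed
    have either: "axis j 1 \<in> V \<or> axis j 1 \<in> W" for j
    proof -
      have "axis j 1 \<in> {x + y | x y. x \<in> V \<and> y \<in> W}"
        using sum by simp
      then obtain x y where xy: "axis j 1 = x + y" "x \<in> V" "y \<in> W"
        by blast
      \<comment> \<open>One of the two components has a nonzero entry at \<open>j\<close>, so its
        summand contains \<open>axis j 1\<close>.\<close>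
      have "x $ j + y $ j = 1"
        using arg_cong[OF xy(1), of "\<lambda>v. v $ j"] by simp
      then have "x $ j \<noteq> 0 \<or> y $ j \<noteq> 0"
        by auto
      then show ?thesis
        using axis_mem_invariant_subspace[OF assms V(1) _ xy(2)]
          axis_mem_invariant_subspace[OF assms W(1) _ xy(3)]
        by blast
    qed
    have edge: "axis j 1 \<in> V" if "axis i 1 \<in> V" "(i, j) \<in> ?Q" for i j
    proof (rule ccontr)
      assume "axis j 1 \<notin> V"
      with either have j: "axis j 1 \<in> W" by blast
      \<comment> \<open>The orientation of the edge decides which summand gains a vector:
        \<open>(j, i)\<close> brings \<open>axis j 1\<close> into \<open>V\<close>, while
        \<open>(i, j)\<close> brings \<open>axis i 1\<close> into \<open>W\<close>.\<close>
      from that(2) have "(i, j) \<in> matrix_supp A \<or> (j, i) \<in> matrix_supp A" by blast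
      then show False
        using axis_mem_invariant_subspace_step[OF assms V(1) that(1), of j]
          axis_mem_invariant_subspace_step[OF assms W(1) j, of i]
          that(1) j not_both by blast
    qed
    obtain i where i: "axis i 1 \<in> V"
      using invariant_subspace_nonzero_axis[OF assms V] by blast
    obtain k where k: "axis k 1 \<in> W"
      using invariant_subspace_nonzero_axis[OF assms W] by blast
    have "(i, k) \<in> ?Q\<^sup>*" using conn by simp
    then have "axis k 1 \<in> V"
      by (induction rule: rtrancl_induct) (use i edge in blast)+
    with k not_both show False by blast
  qed
qed

theorem theorem6:
  fixes l :: "'n::finite \<Rightarrow> complex"
    and A :: "complex^'n^'n"
  assumes "inj l"
    and "\<And>k. l k \<noteq> 0"
  shows "(irreducible_family {diag_matrix l, A} \<longleftrightarrow>
            generates_matrix_algebra (matrix_unit ` matrix_supp A)) \<and>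
         (Schur_irreducible_family {diag_matrix l, A} \<longleftrightarrow>
            generates_matrix_algebra
              (matrix_unit ` (matrix_supp A \<union> matrix_supp (transpose A)))) \<and>
         (indecomposable_family {diag_matrix l, A} \<longleftrightarrow>
            Schur_irreducible_family {diag_matrix l, A})"
  \<comment> \<open>After rewriting, the two sides of each equivalence are the same reachability
    condition.\<close>
  unfolding irreducible_iff_strongly_connected[OF assms(1)]
    Schur_irreducible_iff_connected[OF assms(1)] indecomposable_iff_connected[OF assms(1)]
    generates_matrix_units_iff matrix_supp_transpose
  by simp

end
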